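(* Suppose $p \geq 1$ is a real with $p \neq 2$. Then \[ \min\{|z|^p, |w|^p\} \leq \sigma(z,w) \] for all $z,w \in \mathbb{C}$, where \[ \sigma(z,w) = \frac{\left| 2(|z|^p + |w|^p) - (|z-w|^p + |z+w|^p)\right|}{\left|4 - 2(\sqrt{2})^p\right|}. \] Furthermore, for all $z,w\in\mathbb{C}$: if $1 \leq p < 2$, then \[ 2|z|^p + 2|w|^p - |z+w|^p - |z-w|^p \geq 0, \] and if $2 < p$, then \[ 2|z|^p + 2|w|^p - |z+w|^p - |z-w|^p \leq 0. \] *)

theory Defs
  imports "HOL-Analysis.Analysis"
begin

text \<open>The exponent \<open>p\<close>, implicit in the usual notation \<open>\<sigma>(z,w)\<close>, is an explicit parameter.
  Since \<open>0 powr p = 0\<close> for every real \<open>p\<close>, \<open>norm z powr p\<close> is \<open>|z|\<^sup>p\<close> also at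
  \<open>z = 0\<close> whenever \<open>p > 0\<close>. The denominator is nonzero for \<open>p \<noteq> 2\<close>.\<close>

definition sigma :: "real \<Rightarrow> complex \<Rightarrow> complex \<Rightarrow> real" where
  "sigma p z w =
     \<bar>2 * (norm z powr p + norm w powr p) - (norm (z - w) powr p + norm (z + w) powr p)\<bar>
       / \<bar>4 - 2 * sqrt 2 powr p\<bar>"

end

theory Submission
  imports Defs
begin

text \<open>Put \<open>q = p/2\<close>, so that \<open>|z|\<^sup>p = (|z|\<^sup>2)\<^sup>q\<close> and the claim compares values of a power
  function at squared norms, which are tied together by the parallelogram law
  \<open>|z+w|\<^sup>2 + |z-w|\<^sup>2 = 2(|z|\<^sup>2 + |w|\<^sup>2)\<close>.

  The power \<open>x\<^sup>q\<close> is convex for \<open>q \<ge> 1\<close> and concave for \<open>0 < q \<le> 1\<close>; its multiple \<open>(q-1)x\<^sup>q\<close> is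
  convex in both cases, so both ranges of \<open>p\<close> are handled by a single argument about a convex
  \<open>f\<close> on \<open>[0,\<infinity>)\<close>. Write \<open>A = |z|\<^sup>2\<close> and \<open>B = |w|\<^sup>2\<close> with \<open>B \<le> A\<close>. Convexity at the midpoint
  gives \<open>f(|z+w|\<^sup>2) + f(|z-w|\<^sup>2) \<ge> 2 f(A+B)\<close>, and since \<open>A\<close> and \<open>2B\<close> lie between \<open>B\<close> and
  \<open>A+B\<close> with the same sum, also \<open>f(A+B) + f(B) \<ge> f(A) + f(2B)\<close>. Together
  \[ f(|z+w|^2) + f(|z-w|^2) - 2f(A) - 2f(B) \ge 2f(2B) - 4f(B), \]
  which is lemma \<open>convex_on_parallelogram\<close>; equality holds for orthogonal vectors of equal
  length, which is where the constant \<open>4 - 2(\<surd>2)\<^sup>p\<close> comes from. For \<open>f(x) = (q-1)x\<^sup>q\<close> the right-hand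
  side is \<open>(q-1)(2\<cdot>2\<^sup>q - 4)B\<^sup>q\<close>, and \<open>(q-1)(2\<cdot>2\<^sup>q - 4)\<close> is positive unless \<open>q = 1\<close>. So the
  deviation from the parallelogram law is zero or has the sign of \<open>q-1\<close>, and the lower bound on
  its size is the one claimed.\<close>

text \<open>The two-point case of the majorization inequality of Hardy, Littlewood and Polya: \<open>b\<close> and
  \<open>c\<close> are the convex combinations of the end points \<open>a\<close>, \<open>d\<close> with interchanged weights, so adding
  the two convexity inequalities leaves total weight one on each end point.\<close>

lemma convex_on_sum_le_sum_outer:
  fixes f :: "real \<Rightarrow> real"
  assumes f: "convex_on I f" and I: "a \<in> I" "d \<in> I"
    and b: "a \<le> b" "b \<le> d" and sum: "b + c = a + d"
  shows "f b + f c \<le> f a + f d"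
proof (cases "a = d")
  case True
  with b sum show ?thesis by simp
next
  case False
  with b have ad: "d - a > 0" by simp
  define t where "t = (b - a) / (d - a)"
  have t: "0 \<le> t" "t \<le> 1"
    using b ad by (auto simp: t_def divide_simps)
  have "t * (d - a) = b - a"
    using ad by (simp add: t_def)
  then have bc: "b = (1 - t) *\<^sub>R a + t *\<^sub>R d" "c = (1 - t) *\<^sub>R d + t *\<^sub>R a"
    using sum by (simp_all add: algebra_simps)
  have "f b \<le> (1 - t) * f a + t * f d" "f c \<le> (1 - t) * f d + t * f a"
    unfolding bc using convex_onD[OF f t] I by blast+
  then show ?thesis
    by (simp add: algebra_simps)
qed

lemma convex_on_parallelogram_ordered:
  fixes x y :: "'a :: real_inner" and f :: "real \<Rightarrow> real"
  assumes f: "convex_on {0..} f" and le: "norm y \<le> norm x"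
  shows "2 * f (2 * (norm y)\<^sup>2) - 4 * f ((norm y)\<^sup>2)
    \<le> f ((norm (x + y))\<^sup>2) + f ((norm (x - y))\<^sup>2) - 2 * f ((norm x)\<^sup>2) - 2 * f ((norm y)\<^sup>2)"
proof -
  let ?A = "(norm x)\<^sup>2" and ?B = "(norm y)\<^sup>2"
  let ?P = "(norm (x + y))\<^sup>2" and ?M = "(norm (x - y))\<^sup>2"
  have PM: "?P + ?M = 2 * (?A + ?B)"
    by (simp add: power2_norm_eq_inner inner_add_left inner_add_right
        inner_diff_left inner_diff_right)
  have "f (?A + ?B) + f (?A + ?B) \<le> f ?P + f ?M"
  proof -
    have "(1 - 1 / 2) *\<^sub>R ?P + (1 / 2) *\<^sub>R ?M = ?A + ?B"
      using PM by (simp add: field_simps)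
    then show ?thesis
      using convex_onD[OF f, of "1 / 2" ?P ?M] by simp
  qed
  moreover have "f ?A + f (2 * ?B) \<le> f ?B + f (?A + ?B)"
    using convex_on_sum_le_sum_outer[OF f, of ?B "?A + ?B" ?A "2 * ?B"] le
    by (simp add: power_mono)
  ultimately show ?thesis by linarith
qed

text \<open>The left-hand side is the value that the right-hand side takes at two orthogonal vectors
  both of the length of the shorter of \<open>x\<close> and \<open>y\<close>, so the bound is sharp.\<close>

lemma convex_on_parallelogram:
  fixes x y :: "'a :: real_inner" and f :: "real \<Rightarrow> real"
  assumes f: "convex_on {0..} f"
  defines "m \<equiv> (min (norm x) (norm y))\<^sup>2"
  shows "2 * f (2 * m) - 4 * f m
    \<le> f ((norm (x + y))\<^sup>2) + f ((norm (x - y))\<^sup>2) - 2 * f ((norm x)\<^sup>2) - 2 * f ((norm y)\<^sup>2)"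
proof (cases "norm y \<le> norm x")
  case True
  then show ?thesis
    using convex_on_parallelogram_ordered[OF f, of y x] by (simp add: m_def min_absorb2)
next
  case False
  then show ?thesis
    using convex_on_parallelogram_ordered[OF f, of x y]
    by (simp add: m_def min_absorb1 norm_minus_commute add.commute)
qed

text \<open>On \<open>(0,\<infinity>)\<close> the second derivative is \<open>q(q-1)\<^sup>2x\<^bsup>q-2\<^esup> \<ge> 0\<close>. This criterion
  does not reach \<open>0\<close>, where for \<open>q < 1\<close> not even the first derivative exists; on segments starting
  at \<open>0\<close> convexity instead says
  \<open>(q-1)t\<^sup>q \<le> (q-1)t\<close> for \<open>t \<in> (0,1)\<close>.\<close>

lemma convex_on_scaled_powr:
  fixes q :: real
  assumes q: "q > 0"
  shows "convex_on {0..} (\<lambda>x. (q - 1) * x powr q)"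
proof (rule convex_on_linorderI)
  have pos: "convex_on {0<..} (\<lambda>x. (q - 1) * x powr q)"
  proof (rule f''_ge0_imp_convex)
    fix x :: real assume x: "x \<in> {0<..}"
    show "((\<lambda>x. (q - 1) * x powr q) has_real_derivative (q - 1) * (q * x powr (q - 1))) (at x)"
      using x by (auto intro!: derivative_eq_intros)
    show "((\<lambda>x. (q - 1) * (q * x powr (q - 1))) has_real_derivative
        q * (q - 1)\<^sup>2 * x powr (q - 2)) (at x)"
      using x by (auto intro!: derivative_eq_intros simp: power2_eq_square algebra_simps)
    show "q * (q - 1)\<^sup>2 * x powr (q - 2) \<ge> 0"
      using q by simp
  qed simp
  fix t x y :: real
  assume t: "t > 0" "t < 1" and xy: "x \<in> {0..}" "y \<in> {0..}" "x < y"
  show "(q - 1) * ((1 - t) *\<^sub>R x + t *\<^sub>R y) powr q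
    \<le> (1 - t) * ((q - 1) * x powr q) + t * ((q - 1) * y powr q)"
  proof (cases "x = 0")
    case True
    have "(q - 1) * t powr q \<le> (q - 1) * t powr 1"
    proof (cases "q \<ge> 1")
      case True
      then show ?thesis
        using t by (intro mult_left_mono powr_mono') auto
    next
      case False
      then show ?thesis
        using t by (intro mult_left_mono_neg powr_mono') auto
    qed
    then have "(q - 1) * t powr q * y powr q \<le> (q - 1) * t * y powr q"
      using t by (intro mult_right_mono) auto
    then show ?thesis
      using True t xy by (simp add: powr_mult mult_ac)
  next
    case False
    then show ?thesis
      using convex_onD[OF pos, of t x y] t xy by simp
  qed
qed simp

lemma power2_powr_half:
  fixes r p :: real
  assumes "r \<ge> 0"
  shows "(r\<^sup>2) powr (p / 2) = r powr p"
proof (cases "r = 0")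
  case False
  with assms have "r\<^sup>2 = r powr 2" by simp
  then show ?thesis by (simp add: powr_powr)
qed simp

text \<open>The factor \<open>p/2 - 1\<close> stays on both sides because its sign is what distinguishes \<open>p < 2\<close>
  from \<open>p > 2\<close>.\<close>

lemma norm_powr_parallelogram:
  fixes x y :: "'a :: real_inner" and p :: real
  assumes p: "p > 0"
  shows "(p / 2 - 1) * (2 * sqrt 2 powr p - 4) * min (norm x powr p) (norm y powr p)
    \<le> (p / 2 - 1) * (norm (x + y) powr p + norm (x - y) powr p
                      - 2 * norm x powr p - 2 * norm y powr p)"
proof -
  define n where "n = min (norm x) (norm y)"
  have n: "n \<ge> 0" by (simp add: n_def)
  have min: "min (norm x powr p) (norm y powr p) = n powr p"
    unfolding n_def using p by (smt (verit) norm_ge_zero powr_mono2)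
  have two: "(2 * n\<^sup>2) powr (p / 2) = sqrt 2 powr p * n powr p"
    using power2_powr_half[of "sqrt 2" p] power2_powr_half[OF n, of p]
    by (simp add: powr_mult)
  have "convex_on {0..} (\<lambda>x. (p / 2 - 1) * x powr (p / 2))"
    using p by (intro convex_on_scaled_powr) simp
  from convex_on_parallelogram[OF this, of x y]
  show ?thesis
    unfolding n_def[symmetric] two min
    by (simp add: power2_powr_half n algebra_simps)
qed

lemma sqrt2_powr_deviation_sign:
  fixes p :: real
  shows "p < 2 \<Longrightarrow> 2 * sqrt 2 powr p - 4 < 0" and "p > 2 \<Longrightarrow> 2 * sqrt 2 powr p - 4 > 0"
proof -
  have eq: "sqrt 2 powr 2 = 2" by simp
  show "2 * sqrt 2 powr p - 4 < 0" if "p < 2"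
    using powr_less_mono[OF that, of "sqrt 2"] eq by simp
  show "2 * sqrt 2 powr p - 4 > 0" if "p > 2"
    using powr_less_mono[OF that, of "sqrt 2"] eq by simp
qed

theorem theorem4p4:
  fixes p :: real
  assumes "p \<ge> 1" and "p \<noteq> 2"
  shows "(\<forall>z w :: complex. min (norm z powr p) (norm w powr p) \<le> sigma p z w) \<and>
    (\<forall>z w :: complex.
      (1 \<le> p \<and> p < 2 \<longrightarrow>
        2 * norm z powr p + 2 * norm w powr p
          - norm (z + w) powr p - norm (z - w) powr p \<ge> 0) \<and>
      (2 < p \<longrightarrow>
        2 * norm z powr p + 2 * norm w powr p
          - norm (z + w) powr p - norm (z - w) powr p \<le> 0))"
proof -
  define K where "K = 2 * sqrt 2 powr p - 4"
  define D where "D z w = norm (z + w) powr p + norm (z - w) powr p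
    - 2 * norm z powr p - 2 * norm w powr p" for z w :: complex
  define m where "m z w = min (norm z powr p) (norm w powr p)" for z w :: complex
  have m: "m z w \<ge> 0" for z w
    by (simp add: m_def)
  have main: "(p / 2 - 1) * (K * m z w) \<le> (p / 2 - 1) * D z w" for z w
    using norm_powr_parallelogram[of p z w] assms(1)
    by (simp add: K_def D_def m_def mult.assoc)
  have less: "D z w \<le> K * m z w" "K * m z w \<le> 0" "K < 0" if "p < 2" for z w
  proof -
    show K: "K < 0" using sqrt2_powr_deviation_sign(1)[OF that] by (simp add: K_def)
    show "D z w \<le> K * m z w"
      using main[of z w] that by (simp add: mult_le_cancel_left)
    show "K * m z w \<le> 0" using K m by (simp add: mult_nonpos_nonneg)
  qed
  have greater: "D z w \<ge> K * m z w" "K * m z w \<ge> 0" "K > 0" if "p > 2" for z w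
  proof -
    show K: "K > 0" using sqrt2_powr_deviation_sign(2)[OF that] by (simp add: K_def)
    show "D z w \<ge> K * m z w"
      using main[of z w] that by (simp add: mult_le_cancel_left)
    show "K * m z w \<ge> 0" using K m by simp
  qed
  have sigma: "sigma p z w = \<bar>D z w\<bar> / \<bar>K\<bar>" for z w
  proof -
    have "2 * (norm z powr p + norm w powr p) - (norm (z - w) powr p + norm (z + w) powr p)
        = - D z w" "4 - 2 * sqrt 2 powr p = - K"
      by (simp_all add: D_def K_def)
    then show ?thesis
      unfolding sigma_def by simp
  qed
  have "m z w \<le> sigma p z w" for z w
  proof (cases "p < 2")
    case True
    then show ?thesis
      using less(1,2)[OF True, of z w] less(3)[OF True] by (simp add: sigma field_simps)
  next
    case False
    with assms(2) have "p > 2" by simp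
    then show ?thesis
      using greater(1,2)[OF \<open>p > 2\<close>, of z w] greater(3)[OF \<open>p > 2\<close>] by (simp add: sigma field_simps)
  qed
  moreover have "D z w \<le> 0" if "p < 2" for z w
    using less(1,2)[OF that, of z w] by linarith
  moreover have "D z w \<ge> 0" if "p > 2" for z w
    using greater(1,2)[OF that, of z w] by linarith
  ultimately show ?thesis
    unfolding D_def m_def by (smt (verit))
qed

end
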